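(* Let $J$ be a proximinal subspace of a Banach space $X$ and let $P_J$ denote the metric projection onto $J$. Then the following statements are equivalent: (a) $(X,J)$ has the quotient lifting property (QLP); (b) $P_J$ has a linear selection.
   Context: For a closed subspace $J$ of a Banach space $X$, $\pi:X\to X/J$ is the quotient map. The pair $(X,J)$ has the quotient lifting property (QLP) if for every Banach space $Y$ and every bounded linear operator $S:Y\to X/J$ there is a bounded linear operator $T:Y\to X$ with $\pi\circ T=S$ and $\|T\|=\|S\|$. The metric projection onto $J$ is the set-valued map $P_J(x)=\{j\in J:\|x-j\|=\mathrm{dist}(x,J)\}$; $J$ is proximinal if $P_J(x)\neq\emptyset$ for every $x\in X$. A linear selection for $P_J$ is a linear map $p:X\to J$ with $p(x)\in P_J(x)$ for every $x\in X$. *)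

theory Defs
  imports "HOL-Analysis.Analysis" "HOL-Algebra.QuotRing" "HOL-Algebra.Module"
begin

text \<open>
  The quotient lifting property quantifies over all Banach spaces, which a type class cannot
  express inside a formula. Banach spaces are therefore carrier-based: modules of HOL-Algebra
  with a norm (the ring multiplication and unit that the module record inherits play no role).

  The scalars are a type of sort \<open>{real_normed_field, banach}\<close>. Both \<^typ>\<open>real\<close> and
  \<^typ>\<open>complex\<close> have this sort and, by the Gelfand-Mazur theorem, there are no other cases up to
  isomorphism; so real and complex Banach spaces are treated at once.
\<close>

definition scalars :: "'k::field ring"
  where "scalars = \<lparr>carrier = UNIV, mult = (*), one = 1, zero = 0, add = (+)\<rparr>"

record ('k, 'v) normed_space = "('k, 'v) module" +
  nrm :: "'v \<Rightarrow> real"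

text \<open>
  The value off the carrier is fixed because \<^locale>\<open>Metric_space\<close> demands a nonnegative symmetric
  function on the whole type.
\<close>

definition nrm_dist :: "('k, 'v) normed_space \<Rightarrow> 'v \<Rightarrow> 'v \<Rightarrow> real"
  where "nrm_dist X x y =
    (if x \<in> carrier X \<and> y \<in> carrier X then nrm X (x \<ominus>\<^bsub>X\<^esub> y) else 0)"

locale banach_space = Module.module scalars X
  for X :: "('k::{real_normed_field, banach}, 'v) normed_space" (structure) +
  assumes nrm_nonneg: "x \<in> carrier X \<Longrightarrow> 0 \<le> nrm X x"
    and nrm_eq_zero_iff: "x \<in> carrier X \<Longrightarrow> nrm X x = 0 \<longleftrightarrow> x = \<zero>\<^bsub>X\<^esub>"
    and nrm_smult: "x \<in> carrier X \<Longrightarrow> nrm X (c \<odot>\<^bsub>X\<^esub> x) = norm c * nrm X x"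
    and nrm_triangle:
      "x \<in> carrier X \<Longrightarrow> y \<in> carrier X \<Longrightarrow> nrm X (x \<oplus>\<^bsub>X\<^esub> y) \<le> nrm X x + nrm X y"
    and complete: "Metric_space.mcomplete (carrier X) (nrm_dist X)"

definition closed_subspace ::
    "('k::{real_normed_field, banach}, 'v) normed_space \<Rightarrow> 'v set \<Rightarrow> bool"
  where "closed_subspace X J \<longleftrightarrow>
    submodule J scalars X \<and> closedin (Metric_space.mtopology (carrier X) (nrm_dist X)) J"

definition linear_op ::
    "('k::{real_normed_field, banach}, 'v) normed_space \<Rightarrow> ('k, 'w) normed_space
      \<Rightarrow> ('v \<Rightarrow> 'w) \<Rightarrow> bool"
  where "linear_op X Y T \<longleftrightarrow>
    T \<in> carrier X \<rightarrow> carrier Y \<and>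
    (\<forall>x\<in>carrier X. \<forall>y\<in>carrier X. T (x \<oplus>\<^bsub>X\<^esub> y) = T x \<oplus>\<^bsub>Y\<^esub> T y) \<and>
    (\<forall>c. \<forall>x\<in>carrier X. T (c \<odot>\<^bsub>X\<^esub> x) = c \<odot>\<^bsub>Y\<^esub> T x)"

definition bounded_linear_op ::
    "('k::{real_normed_field, banach}, 'v) normed_space \<Rightarrow> ('k, 'w) normed_space
      \<Rightarrow> ('v \<Rightarrow> 'w) \<Rightarrow> bool"
  where "bounded_linear_op X Y T \<longleftrightarrow>
    linear_op X Y T \<and> (\<exists>B. \<forall>x\<in>carrier X. nrm Y (T x) \<le> B * nrm X x)"

definition op_norm ::
    "('k, 'v) normed_space \<Rightarrow> ('k, 'w) normed_space \<Rightarrow> ('v \<Rightarrow> 'w) \<Rightarrow> real"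
  where "op_norm X Y T = (SUP x\<in>{x \<in> carrier X. nrm X x \<le> 1}. nrm Y (T x))"

text \<open>
  The quotient \<open>X/J\<close> has the additive cosets of \<open>J\<close> as elements. Scalar multiplication adds \<open>J\<close>
  back so that \<open>0 \<cdot> (J + x) = J\<close>, as \<^const>\<open>rcoset_mult\<close> does for quotient rings.
\<close>

definition quot_space :: "('k, 'v) normed_space \<Rightarrow> 'v set \<Rightarrow> ('k, 'v set) normed_space"
  where "quot_space X J =
    \<lparr>carrier = a_rcosets\<^bsub>X\<^esub> J, mult = undefined, one = undefined,
     zero = J, add = set_add X,
     smult = (\<lambda>c A. \<Union>a\<in>A. J +>\<^bsub>X\<^esub> (c \<odot>\<^bsub>X\<^esub> a)),
     nrm = (\<lambda>A. INF a\<in>A. nrm X a)\<rparr>"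

definition quot_map :: "('k, 'v) normed_space \<Rightarrow> 'v set \<Rightarrow> 'v \<Rightarrow> 'v set"
  where "quot_map X J x = J +>\<^bsub>X\<^esub> x"

text \<open>
  The quotient lifting property with \<open>Y\<close> ranging over all Banach spaces whose points are
  elements of the type \<open>'u\<close>.
\<close>

definition QLP ::
    "'u itself \<Rightarrow> ('k::{real_normed_field, banach}, 'v) normed_space \<Rightarrow> 'v set \<Rightarrow> bool"
  where "QLP U X J \<longleftrightarrow>
    (\<forall>(Y :: ('k, 'u) normed_space) S.
       banach_space Y \<and> bounded_linear_op Y (quot_space X J) S \<longrightarrow>
       (\<exists>T. bounded_linear_op Y X T \<and>
            (\<forall>y\<in>carrier Y. quot_map X J (T y) = S y) \<and>
            op_norm Y X T = op_norm Y (quot_space X J) S))"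

definition dist_to :: "('k, 'v) normed_space \<Rightarrow> 'v \<Rightarrow> 'v set \<Rightarrow> real"
  where "dist_to X x J = (INF j\<in>J. nrm_dist X x j)"

definition metric_projection :: "('k, 'v) normed_space \<Rightarrow> 'v set \<Rightarrow> 'v \<Rightarrow> 'v set"
  where "metric_projection X J x = {j \<in> J. nrm_dist X x j = dist_to X x J}"

definition proximinal :: "('k, 'v) normed_space \<Rightarrow> 'v set \<Rightarrow> bool"
  where "proximinal X J \<longleftrightarrow> (\<forall>x\<in>carrier X. metric_projection X J x \<noteq> {})"

definition linear_selection ::
    "('k::{real_normed_field, banach}, 'v) normed_space \<Rightarrow> 'v set \<Rightarrow> ('v \<Rightarrow> 'v) \<Rightarrow> bool"
  where "linear_selection X J p \<longleftrightarrow>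
    linear_op X (X\<lparr>carrier := J\<rparr>) p \<and> (\<forall>x\<in>carrier X. p x \<in> metric_projection X J x)"

end

theory Submission
  imports Defs
begin

text \<open>
  A linear selection of the metric projection and a norm-preserving linear right inverse of the
  quotient map \<open>\<pi> : X \<rightarrow> X/J\<close> determine one another: given \<open>T : X/J \<rightarrow> X\<close>, put \<open>p x = x - T (\<pi> x)\<close>;
  given \<open>p\<close>, the map \<open>x \<mapsto> x - p x\<close> factors through \<open>\<pi>\<close>. The link between the norms is that
  \<open>j \<in> J\<close> is a best approximation of \<open>x\<close> exactly when \<open>x - j\<close> attains the quotient norm of
  \<open>\<pi> x\<close> (\<open>metric_projection_iff\<close>).

  From the lifting property to a selection (\<open>linear_selection_if_QLP\<close>): lift the identity of \<open>X/J\<close>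
  to \<open>T\<close>. Its norm is at most \<open>1\<close>, so \<open>\<parallel>T (\<pi> x)\<parallel> \<le> \<parallel>\<pi> x\<parallel>\<close>, and the reverse inequality holds because
  \<open>T (\<pi> x)\<close> represents \<open>\<pi> x\<close>. This lifting problem is legitimate only because \<open>X/J\<close> is itself a
  Banach space (\<open>quot_banach_space\<close>), which is where most of the work lies.

  From a selection to the lifting property (\<open>QLP_if_linear_selection\<close>): an element of \<open>J\<close> has only
  itself as best approximation, so \<open>p\<close> is the identity on \<open>J\<close>. By linearity \<open>x - p x\<close> then
  depends only on \<open>\<pi> x\<close>, and composing the resulting isometric right inverse of \<open>\<pi>\<close> with \<open>S\<close>
  preserves the norm of every value, hence the operator norm. The lifting is built from
  \<open>S\<close> point by point, so it exists for spaces \<open>Y\<close> over any type of points.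
\<close>

section \<open>Rapidly Cauchy sequences\<close>

text \<open>
  The bound \<open>2 \<cdot> 2\<^sup>-\<^sup>m - 2 \<cdot> 2\<^sup>-\<^sup>n\<close> on the distance of the terms \<open>m \<le> n\<close> is the geometric sum of the steps
  between them.
\<close>

lemma (in Metric_space) MCauchy_geometric:
  assumes "range x \<subseteq> M" and step: "\<And>n. d (x n) (x (Suc n)) < (1/2) ^ n"
  shows "MCauchy x"
proof -
  have inM: "x n \<in> M" for n
    using assms(1) by auto
  have bound: "d (x m) (x (m + k)) \<le> 2 * (1/2) ^ m - 2 * (1/2) ^ (m + k)" for m k
  proof (induction k)
    case 0
    then show ?case using inM by simp
  next
    case (Suc k)
    have "d (x m) (x (m + Suc k)) \<le> d (x m) (x (m + k)) + d (x (m + k)) (x (Suc (m + k)))"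
      using triangle inM by simp
    then show ?case
      using Suc step[of "m + k"] by simp
  qed
  have le: "d (x m) (x n) \<le> 2 * (1/2) ^ m" if "m \<le> n" for m n
  proof -
    have "(0::real) \<le> (1/2) ^ n" by simp
    moreover have "d (x m) (x n) \<le> 2 * (1/2) ^ m - 2 * (1/2) ^ n"
      using bound[of m "n - m"] that by simp
    ultimately show ?thesis by linarith
  qed
  show ?thesis
    unfolding MCauchy_def
  proof (intro conjI allI impI)
    fix e :: real
    assume "e > 0"
    then obtain N where N: "(1/2::real) ^ N < e / 2"
      using real_arch_pow_inv[of "e / 2" "1/2"] by auto
    have "d (x n) (x n') < e" if "N \<le> n" "N \<le> n'" for n n'
    proof -
      have "(1/2::real) ^ n \<le> (1/2) ^ N" "(1/2::real) ^ n' \<le> (1/2) ^ N"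
        using that by (intro power_decreasing; simp)+
      then show ?thesis
        using le[of n n'] le[of n' n] commute[of "x n" "x n'"] N nat_le_linear[of n n']
        by linarith
    qed
    then show "\<exists>N. \<forall>n n'. N \<le> n \<longrightarrow> N \<le> n' \<longrightarrow> d (x n) (x n') < e" by blast
  qed (use assms in auto)
qed

text \<open>
  Together with the previous lemma this reduces the completeness of a quotient to sequences whose
  steps are small enough to be lifted one at a time.
\<close>

lemma (in Metric_space) MCauchy_fast_subsequence:
  assumes "MCauchy x"
  obtains r :: "nat \<Rightarrow> nat" where "strict_mono r"
    and "\<And>k. d (x (r k)) (x (r (Suc k))) < (1/2) ^ k"
proof -
  have ex: "\<exists>N. \<forall>n\<ge>N. \<forall>n'\<ge>N. d (x n) (x n') < (1/2) ^ k" for k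
    using assms unfolding MCauchy_def by (metis half_gt_zero zero_less_power zero_less_one)
  have "\<exists>r. \<forall>k. (\<forall>n\<ge>r k. \<forall>n'\<ge>r k. d (x n) (x n') < (1/2) ^ k) \<and> r k < r (Suc k)"
  proof (rule dependent_nat_choice)
    show "\<exists>N. \<forall>n\<ge>N. \<forall>n'\<ge>N. d (x n) (x n') < (1/2) ^ 0" by (rule ex)
    fix s k
    obtain N where "\<forall>n\<ge>N. \<forall>n'\<ge>N. d (x n) (x n') < (1/2) ^ Suc k" using ex by blast
    then show "\<exists>y. (\<forall>n\<ge>y. \<forall>n'\<ge>y. d (x n) (x n') < (1/2) ^ Suc k) \<and> s < y"
      by (intro exI[of _ "max N (Suc s)"]) auto
  qed
  then obtain r where "\<And>k. (\<forall>n\<ge>r k. \<forall>n'\<ge>r k. d (x n) (x n') < (1/2) ^ k)" "\<And>k. r k < r (Suc k)"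
    by blast
  then show thesis
    by (intro that[of r]) (auto simp: strict_mono_Suc_iff less_imp_le)
qed

section \<open>Normed modules\<close>

lemma scalars_simps [simp]:
  "carrier scalars = UNIV" "x \<otimes>\<^bsub>scalars\<^esub> y = x * y" "\<one>\<^bsub>scalars\<^esub> = 1"
  "\<zero>\<^bsub>scalars\<^esub> = 0" "x \<oplus>\<^bsub>scalars\<^esub> y = x + y"
  by (simp_all add: scalars_def)

text \<open>
  This is \<^locale>\<open>banach_space\<close> without completeness. The metric it provides is needed on \<open>X/J\<close> in
  order to prove that \<open>X/J\<close> is complete.
\<close>

locale normed_module = Module.module scalars X
  for X :: "('k::{real_normed_field, banach}, 'v) normed_space" (structure) +
  assumes nrm_nonneg: "x \<in> carrier X \<Longrightarrow> 0 \<le> nrm X x"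
    and nrm_eq_zero_iff: "x \<in> carrier X \<Longrightarrow> nrm X x = 0 \<longleftrightarrow> x = \<zero>\<^bsub>X\<^esub>"
    and nrm_smult: "x \<in> carrier X \<Longrightarrow> nrm X (c \<odot>\<^bsub>X\<^esub> x) = norm c * nrm X x"
    and nrm_triangle:
      "x \<in> carrier X \<Longrightarrow> y \<in> carrier X \<Longrightarrow> nrm X (x \<oplus>\<^bsub>X\<^esub> y) \<le> nrm X x + nrm X y"
begin

lemma cring_scalars: "cring (scalars :: 'k ring)" ..

lemma smult_simps:
  "x \<in> carrier X \<Longrightarrow> c \<odot> x \<in> carrier X"
  "x \<in> carrier X \<Longrightarrow> 1 \<odot> x = x"
  "x \<in> carrier X \<Longrightarrow> 0 \<odot> x = \<zero>"
  "x \<in> carrier X \<Longrightarrow> (a + c) \<odot> x = a \<odot> x \<oplus> c \<odot> x"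
  "x \<in> carrier X \<Longrightarrow> (a * c) \<odot> x = a \<odot> (c \<odot> x)"
  "x \<in> carrier X \<Longrightarrow> y \<in> carrier X \<Longrightarrow> c \<odot> (x \<oplus> y) = c \<odot> x \<oplus> c \<odot> y"
  using smult_closed[of c x] smult_one[of x] smult_l_null[of x] smult_l_distr[of a c x]
    smult_assoc1[of a c x] smult_r_distr[of c x y] by simp_all

lemma neg_one_smult:
  assumes "x \<in> carrier X" shows "(- 1) \<odot> x = \<ominus> x"
proof -
  have "(- 1) \<odot> x \<oplus> x = \<zero>"
    using smult_simps(4)[of x "- 1" 1] assms by (simp add: smult_simps)
  then show ?thesis
    using assms M.minus_equality smult_simps(1) by metis
qed

lemma nrm_zero: "nrm X \<zero> = 0"
  by (simp add: nrm_eq_zero_iff)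

lemma nrm_minus: "x \<in> carrier X \<Longrightarrow> nrm X (\<ominus> x) = nrm X x"
  using nrm_smult[of x "- 1"] by (simp add: neg_one_smult)

lemma diff_eq_zero_iff:
  assumes "x \<in> carrier X" "y \<in> carrier X"
  shows "x \<ominus> y = \<zero> \<longleftrightarrow> x = y"
proof
  assume "x \<ominus> y = \<zero>"
  then have "(x \<ominus> y) \<oplus> y = y" using assms by simp
  then show "x = y" using assms by (simp add: a_minus_def M.a_assoc M.l_neg)
qed (use assms in \<open>simp add: a_minus_def M.r_neg\<close>)

lemma diff_diff_cancel:
  assumes "x \<in> carrier X" "y \<in> carrier X"
  shows "x \<ominus> (x \<ominus> y) = y" "(x \<ominus> y) \<ominus> x = \<ominus> y"
proof -
  show "x \<ominus> (x \<ominus> y) = y"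
    using assms by (simp add: a_minus_def M.minus_add M.r_neg2 M.r_neg1)
  have "(x \<ominus> y) \<ominus> x = \<ominus> (x \<ominus> (x \<ominus> y))"
    using assms by (simp add: a_minus_def M.minus_add M.a_comm)
  then show "(x \<ominus> y) \<ominus> x = \<ominus> y"
    using \<open>x \<ominus> (x \<ominus> y) = y\<close> by simp
qed

lemma metric_space: "Metric_space (carrier X) (nrm_dist X)"
proof
  fix x y
  show "0 \<le> nrm_dist X x y"
    by (simp add: nrm_dist_def nrm_nonneg)
  have "nrm X (x \<ominus> y) = nrm X (y \<ominus> x)" if "x \<in> carrier X" "y \<in> carrier X"
    using nrm_minus[of "x \<ominus> y"] that by (simp add: a_minus_def M.minus_add M.a_comm)
  then show "nrm_dist X x y = nrm_dist X y x"
    by (auto simp: nrm_dist_def)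
  show "nrm_dist X x y = 0 \<longleftrightarrow> x = y" if "x \<in> carrier X" "y \<in> carrier X"
    using that by (simp add: nrm_dist_def nrm_eq_zero_iff diff_eq_zero_iff)
  fix z
  show "nrm_dist X x z \<le> nrm_dist X x y + nrm_dist X y z"
    if "x \<in> carrier X" "y \<in> carrier X" "z \<in> carrier X"
  proof -
    have "x \<ominus> z = (x \<ominus> y) \<oplus> (y \<ominus> z)"
      using that by (simp add: a_minus_def M.a_assoc M.r_neg1)
    then show ?thesis
      using that nrm_triangle[of "x \<ominus> y" "y \<ominus> z"] by (simp add: nrm_dist_def)
  qed
qed

sublocale metric: Metric_space "carrier X" "nrm_dist X"
  by (rule metric_space)

end

sublocale banach_space \<subseteq> normed_module
  by unfold_locales (fact nrm_nonneg nrm_eq_zero_iff nrm_smult nrm_triangle)+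

section \<open>Operator norms\<close>

text \<open>
  Homogeneity of both norms allows \<open>y\<close> to be scaled to the unit sphere, where the supremum applies.
  Boundedness of \<open>T\<close> makes that supremum a genuine bound and settles the case \<open>\<parallel>y\<parallel> = 0\<close>.
\<close>

lemma nrm_le_op_norm:
  assumes "banach_space Y" "bounded_linear_op Y Z T" "y \<in> carrier Y"
     and hom: "\<And>c z. z \<in> carrier Z \<Longrightarrow> nrm Z (c \<odot>\<^bsub>Z\<^esub> z) = norm c * nrm Z z"
  shows "nrm Z (T y) \<le> op_norm Y Z T * nrm Y y"
proof -
  interpret Y: banach_space Y by fact
  from assms(2) obtain B where lin: "linear_op Y Z T"
    and B: "\<And>x. x \<in> carrier Y \<Longrightarrow> nrm Z (T x) \<le> B * nrm Y x"
    by (auto simp: bounded_linear_op_def)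
  have bdd: "bdd_above ((\<lambda>x. nrm Z (T x)) ` {x \<in> carrier Y. nrm Y x \<le> 1})"
  proof (rule bdd_aboveI2)
    fix x assume x: "x \<in> {x \<in> carrier Y. nrm Y x \<le> 1}"
    then have "B * nrm Y x \<le> \<bar>B\<bar> * 1"
      using Y.nrm_nonneg[of x] by (intro mult_mono) auto
    then show "nrm Z (T x) \<le> \<bar>B\<bar>" using B[of x] x by simp
  qed
  show ?thesis
  proof (cases "nrm Y y = 0")
    case True
    then show ?thesis using B[OF assms(3)] by simp
  next
    case False
    define t where "t = nrm Y y"
    have t: "t > 0" using False Y.nrm_nonneg[OF assms(3)] by (simp add: t_def)
    define u where "u = of_real (1 / t) \<odot>\<^bsub>Y\<^esub> y"
    have u: "u \<in> carrier Y" "nrm Y u = 1"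
      using t assms(3) by (simp_all add: u_def Y.smult_simps Y.nrm_smult norm_divide t_def)
    have "nrm Z (T u) \<le> op_norm Y Z T"
      unfolding op_norm_def by (rule cSUP_upper[OF _ bdd]) (use u in auto)
    moreover have "nrm Z (T u) = (1 / t) * nrm Z (T y)"
      using lin assms(3) t hom[of "T y"]
      by (simp add: linear_op_def u_def Pi_iff norm_divide)
    ultimately show ?thesis
      using t by (simp add: field_simps flip: t_def)
  qed
qed

lemma op_norm_le:
  assumes "banach_space Y" "0 \<le> B" "\<And>y. y \<in> carrier Y \<Longrightarrow> nrm Z (T y) \<le> B * nrm Y y"
  shows "op_norm Y Z T \<le> B"
proof -
  interpret Y: banach_space Y by fact
  have "\<zero>\<^bsub>Y\<^esub> \<in> {y \<in> carrier Y. nrm Y y \<le> 1}"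
    by (simp add: Y.nrm_zero)
  then show ?thesis
    unfolding op_norm_def
  proof (intro cSUP_least)
    fix y assume y: "y \<in> {y \<in> carrier Y. nrm Y y \<le> 1}"
    then have "nrm Z (T y) \<le> B * nrm Y y" using assms(3) by blast
    also have "\<dots> \<le> B * 1" using y assms(2) by (intro mult_left_mono) auto
    finally show "nrm Z (T y) \<le> B" by simp
  qed auto
qed

section \<open>The quotient of a Banach space by a closed subspace\<close>

locale banach_subspace = banach_space X
  for X :: "('k::{real_normed_field, banach}, 'v) normed_space" (structure) +
  fixes J :: "'v set"
  assumes closed: "closed_subspace X J"
begin

lemma submod: "submodule J scalars X"
  using closed by (simp add: closed_subspace_def)

sublocale sub: abelian_subgroup J X
  using submodule.axioms(1)[OF submod] M.abelian_group_axioms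
  by (intro abelian_subgroupI3 additive_subgroupI)

abbreviation "Q \<equiv> quot_space X J"
abbreviation "\<pi> \<equiv> quot_map X J"

lemma J_smult: "j \<in> J \<Longrightarrow> c \<odot> j \<in> J"
  using submodule.smult_closed[OF submod, of c j] by simp

lemma J_carrier: "j \<in> J \<Longrightarrow> j \<in> carrier X"
  using sub.a_subset by blast

lemma quot_map_closed: "x \<in> carrier X \<Longrightarrow> \<pi> x \<in> carrier Q"
  by (simp add: quot_map_def quot_space_def M.a_rcosetsI sub.a_subset)

lemma quot_carrierE:
  assumes "A \<in> carrier Q" obtains x where "x \<in> carrier X" "A = \<pi> x"
  using assms by (auto simp: quot_space_def quot_map_def A_RCOSETS_def')

lemma quot_map_add:
  "x \<in> carrier X \<Longrightarrow> y \<in> carrier X \<Longrightarrow> \<pi> (x \<oplus> y) = \<pi> x \<oplus>\<^bsub>Q\<^esub> \<pi> y"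
  by (simp add: quot_map_def quot_space_def sub.a_rcos_sum)

lemma mem_quot_map: "x \<in> carrier X \<Longrightarrow> a \<in> \<pi> x \<longleftrightarrow> a \<in> carrier X \<and> a \<ominus> x \<in> J"
proof -
  assume x: "x \<in> carrier X"
  have "a = (a \<ominus> x) \<oplus> x" if "a \<in> carrier X"
    using that x by (simp add: a_minus_def M.a_assoc M.l_neg)
  moreover have "j = (j \<oplus> x) \<ominus> x" if "j \<in> J" for j
    using that x J_carrier[of j] by (simp add: a_minus_def M.a_assoc M.r_neg)
  ultimately show ?thesis
    using x J_carrier by (auto simp: quot_map_def a_r_coset_def')
qed

lemma quot_map_self: "x \<in> carrier X \<Longrightarrow> x \<in> \<pi> x"
  by (simp add: quot_map_def sub.a_rcos_self)

lemma quot_map_eq_iff: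
  assumes "x \<in> carrier X" "y \<in> carrier X"
  shows "\<pi> x = \<pi> y \<longleftrightarrow> x \<ominus> y \<in> J"
proof
  assume "\<pi> x = \<pi> y"
  then show "x \<ominus> y \<in> J" using quot_map_self mem_quot_map assms by blast
next
  assume "x \<ominus> y \<in> J"
  then have "x \<in> \<pi> y" using mem_quot_map assms by blast
  then show "\<pi> x = \<pi> y"
    using M.a_repr_independence[of x J y] assms sub.a_subgroup by (simp add: quot_map_def)
qed

lemma quot_map_eq_zero: "j \<in> J \<Longrightarrow> \<pi> j = J"
  using M.a_coset_join2[OF _ sub.a_subgroup] J_carrier by (simp add: quot_map_def)

lemma quot_zero: "\<zero>\<^bsub>Q\<^esub> = \<pi> \<zero>"
  by (simp add: quot_map_eq_zero) (simp add: quot_space_def)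

text \<open>
  The union that defines the scalar multiple of a coset is a union of equal cosets.
\<close>

lemma quot_map_smult:
  assumes x: "x \<in> carrier X" shows "\<pi> (c \<odot> x) = c \<odot>\<^bsub>Q\<^esub> \<pi> x"
proof -
  have "\<pi> (c \<odot> a) = \<pi> (c \<odot> x)" if "a \<in> \<pi> x" for a
  proof -
    have a: "a \<in> carrier X" "a \<ominus> x \<in> J" using that x by (auto simp: mem_quot_map)
    have "c \<odot> a \<ominus> c \<odot> x = c \<odot> (a \<ominus> x)"
      using a x by (simp add: a_minus_def smult_simps smult_r_minus)
    then show ?thesis using a x J_smult by (simp add: quot_map_eq_iff smult_simps)
  qed
  then have "(\<Union>a\<in>\<pi> x. \<pi> (c \<odot> a)) = \<pi> (c \<odot> x)"
    using quot_map_self[OF x] by blast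
  then show ?thesis by (simp add: quot_space_def quot_map_def)
qed

lemma quot_nrm: "nrm Q A = (INF a\<in>A. nrm X a)"
  by (simp add: quot_space_def)

lemma coset_subset: "A \<in> carrier Q \<Longrightarrow> A \<subseteq> carrier X"
  by (erule quot_carrierE) (auto simp: mem_quot_map)

lemma quot_nrm_bdd: "A \<in> carrier Q \<Longrightarrow> bdd_below (nrm X ` A)"
  by (rule bdd_belowI2[of _ 0]) (use coset_subset nrm_nonneg in blast)

lemma coset_nonempty: "A \<in> carrier Q \<Longrightarrow> A \<noteq> {}"
  by (erule quot_carrierE) (use quot_map_self in blast)

lemma quot_map_mem: "A \<in> carrier Q \<Longrightarrow> a \<in> A \<Longrightarrow> \<pi> a = A"
  by (erule quot_carrierE) (simp add: mem_quot_map quot_map_eq_iff)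

lemma quot_nrm_le: "x \<in> carrier X \<Longrightarrow> nrm Q (\<pi> x) \<le> nrm X x"
  unfolding quot_nrm by (intro cINF_lower quot_nrm_bdd quot_map_closed quot_map_self)

text \<open>
  The infimum defining the quotient norm is approached by representatives but need not be
  attained, so norm estimates on \<open>X/J\<close> are reduced to estimates in \<open>X\<close> up to an arbitrary slack.
\<close>

lemma quot_nrm_lessE:
  assumes "A \<in> carrier Q" "nrm Q A < r"
  obtains x where "x \<in> carrier X" "\<pi> x = A" "nrm X x < r"
  using assms cINF_less_iff[OF coset_nonempty quot_nrm_bdd, of A r]
    coset_subset quot_map_mem unfolding quot_nrm by blast

lemma quot_nrm_nonneg: "A \<in> carrier Q \<Longrightarrow> 0 \<le> nrm Q A"
  unfolding quot_nrm
  by (intro cINF_greatest coset_nonempty) (use coset_subset nrm_nonneg in auto)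

lemma quot_abelian_group: "abelian_group Q"
proof (rule abelian_groupI)
  fix A assume "A \<in> carrier Q"
  then obtain x where x: "x \<in> carrier X" "A = \<pi> x" by (rule quot_carrierE)
  show "\<zero>\<^bsub>Q\<^esub> \<oplus>\<^bsub>Q\<^esub> A = A"
    using x by (simp add: quot_zero flip: quot_map_add)
  show "\<exists>B\<in>carrier Q. B \<oplus>\<^bsub>Q\<^esub> A = \<zero>\<^bsub>Q\<^esub>"
    using x by (intro bexI[of _ "\<pi> (\<ominus> x)"])
      (simp_all add: quot_zero quot_map_closed M.l_neg flip: quot_map_add)
  fix B assume "B \<in> carrier Q"
  then obtain y where y: "y \<in> carrier X" "B = \<pi> y" by (rule quot_carrierE)
  show "A \<oplus>\<^bsub>Q\<^esub> B \<in> carrier Q"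
    using x y by (simp add: quot_map_closed flip: quot_map_add)
  show "A \<oplus>\<^bsub>Q\<^esub> B = B \<oplus>\<^bsub>Q\<^esub> A"
    using x y by (simp add: M.a_comm flip: quot_map_add)
  fix C assume "C \<in> carrier Q"
  then obtain z where z: "z \<in> carrier X" "C = \<pi> z" by (rule quot_carrierE)
  show "A \<oplus>\<^bsub>Q\<^esub> B \<oplus>\<^bsub>Q\<^esub> C = A \<oplus>\<^bsub>Q\<^esub> (B \<oplus>\<^bsub>Q\<^esub> C)"
    using x y z by (simp add: M.a_assoc flip: quot_map_add)
qed (simp add: quot_zero quot_map_closed)

lemma quot_module: "Module.module scalars Q"
proof (rule moduleI)
  fix A B :: "'v set" and a b :: 'k
  assume A: "A \<in> carrier Q"
  then obtain x where x: "x \<in> carrier X" "A = \<pi> x" by (rule quot_carrierE)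
  show "a \<odot>\<^bsub>Q\<^esub> A \<in> carrier Q"
    using x by (simp add: smult_simps quot_map_closed flip: quot_map_smult)
  show "(a \<oplus>\<^bsub>scalars\<^esub> b) \<odot>\<^bsub>Q\<^esub> A = a \<odot>\<^bsub>Q\<^esub> A \<oplus>\<^bsub>Q\<^esub> b \<odot>\<^bsub>Q\<^esub> A"
    using x by (simp add: smult_simps flip: quot_map_smult quot_map_add)
  show "(a \<otimes>\<^bsub>scalars\<^esub> b) \<odot>\<^bsub>Q\<^esub> A = a \<odot>\<^bsub>Q\<^esub> (b \<odot>\<^bsub>Q\<^esub> A)"
    using x by (simp add: smult_simps flip: quot_map_smult)
  show "\<one>\<^bsub>scalars\<^esub> \<odot>\<^bsub>Q\<^esub> A = A"
    using x by (simp add: smult_simps flip: quot_map_smult)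
  assume "B \<in> carrier Q"
  then obtain y where y: "y \<in> carrier X" "B = \<pi> y" by (rule quot_carrierE)
  show "a \<odot>\<^bsub>Q\<^esub> (A \<oplus>\<^bsub>Q\<^esub> B) = a \<odot>\<^bsub>Q\<^esub> A \<oplus>\<^bsub>Q\<^esub> a \<odot>\<^bsub>Q\<^esub> B"
    using x y by (simp add: smult_simps flip: quot_map_smult quot_map_add)
qed (simp_all add: cring_scalars quot_abelian_group)

lemma quot_nrm_smult_le:
  assumes A: "A \<in> carrier Q"
  shows "nrm Q (c \<odot>\<^bsub>Q\<^esub> A) \<le> norm c * nrm Q A"
proof (rule field_le_epsilon)
  fix e :: real assume e: "e > 0"
  \<comment> \<open>The denominator \<open>\<parallel>c\<parallel> + 1\<close> keeps the error below \<open>e\<close> after scaling by \<open>c\<close> and covers \<open>c = 0\<close>.\<close>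
  have "nrm Q A < nrm Q A + e / (norm c + 1)" using e by (simp add: add_nonneg_pos)
  with A obtain x where x: "x \<in> carrier X" "\<pi> x = A" "nrm X x < nrm Q A + e / (norm c + 1)"
    by (rule quot_nrm_lessE)
  have "nrm Q (c \<odot>\<^bsub>Q\<^esub> A) \<le> norm c * nrm X x"
    using quot_nrm_le[of "c \<odot> x"] x by (simp add: quot_map_smult smult_simps nrm_smult)
  also have "\<dots> \<le> norm c * (nrm Q A + e / (norm c + 1))"
    using x by (intro mult_left_mono) auto
  also have "\<dots> \<le> norm c * nrm Q A + e"
  proof -
    have "norm c * (e / (norm c + 1)) \<le> e"
      using e by (simp add: divide_simps add_nonneg_pos add_pos_nonneg algebra_simps)
    then show ?thesis by (simp add: distrib_left)
  qed
  finally show "nrm Q (c \<odot>\<^bsub>Q\<^esub> A) \<le> norm c * nrm Q A + e" .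
qed

text \<open>
  The inequality for \<open>c\<close> and \<open>A\<close> gives the reverse one when applied to \<open>c\<^sup>-\<^sup>1\<close> and \<open>c \<cdot> A\<close>.
\<close>

lemma quot_nrm_smult:
  assumes A: "A \<in> carrier Q"
  shows "nrm Q (c \<odot>\<^bsub>Q\<^esub> A) = norm c * nrm Q A"
proof (cases "c = 0")
  case True
  interpret Q: Module.module scalars Q by (rule quot_module)
  have "0 \<le> nrm Q (c \<odot>\<^bsub>Q\<^esub> A)" by (rule quot_nrm_nonneg) (use A in simp)
  then show ?thesis using quot_nrm_smult_le[OF A, of c] True by simp
next
  case False
  interpret Q: Module.module scalars Q by (rule quot_module)
  have cA: "c \<odot>\<^bsub>Q\<^esub> A \<in> carrier Q" using A by simp
  have "inverse c \<odot>\<^bsub>Q\<^esub> (c \<odot>\<^bsub>Q\<^esub> A) = A"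
    using A False Q.smult_assoc1[of "inverse c" c A] Q.smult_one[of A] by simp
  then have "nrm Q A \<le> inverse (norm c) * nrm Q (c \<odot>\<^bsub>Q\<^esub> A)"
    using quot_nrm_smult_le[OF cA, of "inverse c"] by (simp add: norm_inverse)
  then have "norm c * nrm Q A \<le> nrm Q (c \<odot>\<^bsub>Q\<^esub> A)"
    using False by (simp add: field_simps)
  then show ?thesis using quot_nrm_smult_le[OF A, of c] by simp
qed

lemma quot_nrm_triangle:
  assumes A: "A \<in> carrier Q" and B: "B \<in> carrier Q"
  shows "nrm Q (A \<oplus>\<^bsub>Q\<^esub> B) \<le> nrm Q A + nrm Q B"
proof (rule field_le_epsilon)
  fix e :: real assume e: "e > 0"
  obtain x where x: "x \<in> carrier X" "\<pi> x = A" "nrm X x < nrm Q A + e / 2"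
    using quot_nrm_lessE[OF A, of "nrm Q A + e / 2"] e by auto
  obtain y where y: "y \<in> carrier X" "\<pi> y = B" "nrm X y < nrm Q B + e / 2"
    using quot_nrm_lessE[OF B, of "nrm Q B + e / 2"] e by auto
  have "nrm Q (A \<oplus>\<^bsub>Q\<^esub> B) \<le> nrm X (x \<oplus> y)"
    using quot_nrm_le[of "x \<oplus> y"] x y by (simp add: quot_map_add)
  then show "nrm Q (A \<oplus>\<^bsub>Q\<^esub> B) \<le> nrm Q A + nrm Q B + e"
    using nrm_triangle[of x y] x y by simp
qed

text \<open>
  Closedness of \<open>J\<close> is what makes the quotient seminorm a norm: if \<open>\<pi> x\<close> has arbitrarily small
  representatives \<open>y\<close>, then the elements \<open>x - y\<close> of \<open>J\<close> come arbitrarily close to \<open>x\<close>.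
\<close>

lemma quot_nrm_eq_zero_imp:
  assumes A: "A \<in> carrier Q" and "nrm Q A = 0"
  shows "A = \<zero>\<^bsub>Q\<^esub>"
proof -
  obtain x where x: "x \<in> carrier X" "A = \<pi> x" using A by (rule quot_carrierE)
  have "x \<in> J"
  proof (rule ccontr)
    assume "x \<notin> J"
    then obtain r where r: "r > 0" "disjnt J (metric.mball x r)"
      using closed x metric.closedin_metric[of J] by (auto simp: closed_subspace_def)
    obtain y where y: "y \<in> carrier X" "\<pi> y = A" "nrm X y < r"
      using quot_nrm_lessE[OF A, of r] assms r by auto
    have "x \<ominus> y \<in> J" using x y quot_map_eq_iff by metis
    moreover have "x \<ominus> (x \<ominus> y) = y"
      using x y by (simp add: diff_diff_cancel)
    then have "x \<ominus> y \<in> metric.mball x r"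
      using x y by (simp add: nrm_dist_def)
    ultimately show False using r by (auto simp: disjnt_iff)
  qed
  then show ?thesis using x quot_map_eq_zero by (simp add: quot_zero)
qed

lemma quot_map_diff:
  assumes "x \<in> carrier X" "y \<in> carrier X"
  shows "\<pi> x \<ominus>\<^bsub>Q\<^esub> \<pi> y = \<pi> (x \<ominus> y)"
proof -
  interpret Q: abelian_group Q by (rule quot_abelian_group)
  have "\<pi> x = \<pi> (x \<ominus> y) \<oplus>\<^bsub>Q\<^esub> \<pi> y"
    using assms by (simp add: a_minus_def M.a_assoc M.l_neg flip: quot_map_add)
  then show ?thesis
    using assms quot_map_closed by (simp add: a_minus_def Q.a_assoc Q.r_neg)
qed

lemma quot_dist_le:
  "x \<in> carrier X \<Longrightarrow> y \<in> carrier X \<Longrightarrow> nrm_dist Q (\<pi> x) (\<pi> y) \<le> nrm_dist X x y"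
  by (simp add: nrm_dist_def quot_map_closed quot_map_diff quot_nrm_le)

text \<open>
  A step between two cosets lifts to a step from any prescribed representative of the first one,
  with the same strict bound on its length. Hence a sequence of cosets can be lifted recursively.
\<close>

lemma quot_dist_lessE:
  assumes x: "x \<in> carrier X" and B: "B \<in> carrier Q" and "nrm_dist Q (\<pi> x) B < r"
  obtains y where "y \<in> carrier X" "\<pi> y = B" "nrm_dist X x y < r"
proof -
  obtain z where z: "z \<in> carrier X" "B = \<pi> z" using B by (rule quot_carrierE)
  have "nrm Q (\<pi> (x \<ominus> z)) < r"
    using assms z by (simp add: nrm_dist_def quot_map_diff quot_map_closed)
  then obtain d where d: "d \<in> carrier X" "\<pi> d = \<pi> (x \<ominus> z)" "nrm X d < r"
    using quot_nrm_lessE quot_map_closed x z by (metis M.minus_closed)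
  have eq: "x \<ominus> d \<ominus> z = \<ominus> (d \<ominus> (x \<ominus> z))"
    using x z d by (simp add: a_minus_def M.minus_add M.a_ac)
  have "d \<ominus> (x \<ominus> z) \<in> J"
    using d x z quot_map_eq_iff by (metis M.minus_closed)
  then have "x \<ominus> d \<ominus> z \<in> J" using eq sub.a_inv_closed by metis
  then have "\<pi> (x \<ominus> d) = B" using x z d by (simp add: quot_map_eq_iff)
  then show thesis
    using that[of "x \<ominus> d"] x d by (simp add: nrm_dist_def diff_diff_cancel)
qed

lemma quot_normed_module: "normed_module Q"
proof (intro normed_module.intro normed_module_axioms.intro quot_module)
  fix A assume A: "A \<in> carrier Q"
  have "nrm Q \<zero>\<^bsub>Q\<^esub> = 0"
    using quot_nrm_le[of \<zero>] quot_nrm_nonneg[OF quot_map_closed, of \<zero>] nrm_zero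
    by (simp add: quot_zero)
  then show "nrm Q A = 0 \<longleftrightarrow> A = \<zero>\<^bsub>Q\<^esub>"
    using quot_nrm_eq_zero_imp[OF A] by blast
qed (simp_all add: quot_nrm_nonneg quot_nrm_smult quot_nrm_triangle)

text \<open>
  A subsequence with steps below \<open>2\<^sup>-\<^sup>k\<close> is lifted term by term to a Cauchy sequence in \<open>X\<close>. The image
  of its limit is the limit of the subsequence, hence of the whole Cauchy sequence.
\<close>

lemma quot_complete: "Metric_space.mcomplete (carrier Q) (nrm_dist Q)"
proof -
  interpret Q: Metric_space "carrier Q" "nrm_dist Q" by (rule normed_module.metric_space[OF quot_normed_module])
  show ?thesis
    unfolding Q.mcomplete_def
  proof (intro allI impI)
    fix \<sigma> assume \<sigma>: "Q.MCauchy \<sigma>"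
    then obtain r where r: "strict_mono r"
      and fast: "\<And>k. nrm_dist Q (\<sigma> (r k)) (\<sigma> (r (Suc k))) < (1/2) ^ k"
      using Q.MCauchy_fast_subsequence by metis
    have mem: "\<sigma> n \<in> carrier Q" for n
      using \<sigma> by (auto simp: Q.MCauchy_def)
    have "\<exists>x. \<forall>k. (x k \<in> carrier X \<and> \<pi> (x k) = \<sigma> (r k)) \<and>
        nrm_dist X (x k) (x (Suc k)) < (1/2) ^ k"
    proof (rule dependent_nat_choice)
      show "\<exists>x. x \<in> carrier X \<and> \<pi> x = \<sigma> (r 0)"
        using quot_carrierE[OF mem] by metis
      show "\<exists>y. (y \<in> carrier X \<and> \<pi> y = \<sigma> (r (Suc k))) \<and> nrm_dist X x y < (1/2) ^ k"
        if "x \<in> carrier X \<and> \<pi> x = \<sigma> (r k)" for x k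
        using quot_dist_lessE[of x "\<sigma> (r (Suc k))" "(1/2) ^ k"] that fast[of k] mem by metis
    qed
    then obtain x where x: "\<And>k. x k \<in> carrier X" "\<And>k. \<pi> (x k) = \<sigma> (r k)"
      "\<And>k. nrm_dist X (x k) (x (Suc k)) < (1/2) ^ k" by blast
    have "metric.MCauchy x"
      using x by (intro metric.MCauchy_geometric) auto
    then obtain l where l: "limitin metric.mtopology x l sequentially"
      using complete metric.mcomplete_def by blast
    then have lc: "l \<in> carrier X" using metric.limitin_mspace by blast
    have "limitin Q.mtopology (\<sigma> \<circ> r) (\<pi> l) sequentially"
      unfolding Q.limit_metric_sequentially
    proof (intro conjI allI impI)
      show "\<pi> l \<in> carrier Q" using lc by (rule quot_map_closed)
      fix e :: real assume "e > 0"
      then obtain N where "\<forall>n\<ge>N. x n \<in> carrier X \<and> nrm_dist X (x n) l < e"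
        using l unfolding metric.limit_metric_sequentially by blast
      then show "\<exists>N. \<forall>n\<ge>N. (\<sigma> \<circ> r) n \<in> carrier Q \<and> nrm_dist Q ((\<sigma> \<circ> r) n) (\<pi> l) < e"
        using quot_dist_le[OF x(1) lc] mem x(2) by (metis comp_apply order_le_less_trans)
    qed
    then show "\<exists>A. limitin Q.mtopology \<sigma> A sequentially"
      using Q.MCauchy_convergent_subsequence[OF \<sigma> r] by blast
  qed
qed

lemma quot_banach_space: "banach_space Q"
proof -
  interpret Q: normed_module Q by (rule quot_normed_module)
  show ?thesis
    by (intro banach_space.intro banach_space_axioms.intro quot_module quot_complete)
      (fact Q.nrm_nonneg Q.nrm_eq_zero_iff Q.nrm_smult Q.nrm_triangle)+
qed

section \<open>Selections of the metric projection and liftings\<close>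

text \<open>
  The map \<open>j \<mapsto> x - j\<close> carries \<open>J\<close> onto the coset \<open>\<pi> x\<close>, so the distance of \<open>x\<close> to \<open>J\<close> is the quotient
  norm of \<open>\<pi> x\<close>.
\<close>

lemma metric_projection_iff:
  assumes x: "x \<in> carrier X"
  shows "j \<in> metric_projection X J x \<longleftrightarrow> j \<in> J \<and> nrm X (x \<ominus> j) = nrm Q (\<pi> x)"
proof -
  have "nrm_dist X x ` J = nrm X ` \<pi> x"
  proof (intro equalityI image_subsetI)
    fix j assume j: "j \<in> J"
    have "x \<ominus> j \<in> \<pi> x"
      using x j J_carrier[OF j] by (simp add: mem_quot_map diff_diff_cancel)
    then show "nrm_dist X x j \<in> nrm X ` \<pi> x"
      using x J_carrier[OF j] by (simp add: nrm_dist_def)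
  next
    fix a assume "a \<in> \<pi> x"
    then have a: "a \<in> carrier X" "a \<ominus> x \<in> J" using x by (auto simp: mem_quot_map)
    have "x \<ominus> a = \<ominus> (a \<ominus> x)"
      using a x by (simp add: a_minus_def M.minus_add M.a_comm)
    then have "x \<ominus> a \<in> J" using a by simp
    moreover have "x \<ominus> (x \<ominus> a) = a"
      using x a by (simp add: diff_diff_cancel)
    then have "nrm X a = nrm_dist X x (x \<ominus> a)"
      using x a by (simp add: nrm_dist_def)
    ultimately show "nrm X a \<in> nrm_dist X x ` J" by blast
  qed
  then have "dist_to X x J = nrm Q (\<pi> x)"
    by (simp add: dist_to_def quot_nrm)
  then show ?thesis
    using x J_carrier by (auto simp: metric_projection_def nrm_dist_def)
qed

lemma linear_selection_if_QLP:
  assumes "QLP TYPE('v set) X J"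
  shows "\<exists>p. linear_selection X J p"
proof -
  have id: "bounded_linear_op Q Q (\<lambda>A. A)"
    unfolding bounded_linear_op_def linear_op_def by (auto intro: exI[of _ 1])
  have "\<exists>T. bounded_linear_op Q X T \<and> (\<forall>A\<in>carrier Q. \<pi> (T A) = A) \<and>
      op_norm Q X T = op_norm Q Q (\<lambda>A. A)"
    by (rule assms[unfolded QLP_def, rule_format]) (intro conjI quot_banach_space id)
  then obtain T where T: "bounded_linear_op Q X T"
    and lift: "\<And>A. A \<in> carrier Q \<Longrightarrow> \<pi> (T A) = A"
    and norm_T: "op_norm Q X T = op_norm Q Q (\<lambda>A. A)"
    by blast
  have lin: "linear_op Q X T" using T by (simp add: bounded_linear_op_def)
  have T_closed: "T A \<in> carrier X" if "A \<in> carrier Q" for A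
    using lin that by (auto simp: linear_op_def)
  have T_le: "nrm X (T A) \<le> nrm Q A" if A: "A \<in> carrier Q" for A
  proof -
    have "op_norm Q X T \<le> 1"
      unfolding norm_T by (rule op_norm_le[OF quot_banach_space]) auto
    then have "op_norm Q X T * nrm Q A \<le> 1 * nrm Q A"
      using quot_nrm_nonneg[OF A] by (intro mult_right_mono)
    then show ?thesis
      using nrm_le_op_norm[OF quot_banach_space T A] nrm_smult by force
  qed
  define p where "p x = x \<ominus> T (\<pi> x)" for x
  have p_best: "p x \<in> metric_projection X J x" if x: "x \<in> carrier X" for x
  proof -
    let ?t = "T (\<pi> x)"
    have t: "?t \<in> carrier X" "\<pi> ?t = \<pi> x"
      using x quot_map_closed T_closed lift by auto
    have "x \<ominus> p x = ?t"
      using x t by (simp add: p_def diff_diff_cancel)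
    moreover have "nrm X ?t = nrm Q (\<pi> x)"
      using T_le[OF quot_map_closed[OF x]] quot_nrm_le[OF t(1)] t(2) by simp
    moreover have "p x \<in> J"
      using quot_map_eq_iff[OF x t(1)] t(2) by (simp add: p_def)
    ultimately show ?thesis using x by (simp add: metric_projection_iff)
  qed
  have "p (x \<oplus> y) = p x \<oplus> p y" if xy: "x \<in> carrier X" "y \<in> carrier X" for x y
  proof -
    have "T (\<pi> (x \<oplus> y)) = T (\<pi> x) \<oplus> T (\<pi> y)"
      using lin xy quot_map_closed by (simp add: quot_map_add linear_op_def)
    then show ?thesis
      using xy T_closed quot_map_closed
      by (simp add: p_def a_minus_def M.minus_add M.a_ac)
  qed
  moreover have "p (c \<odot> x) = c \<odot> p x" if x: "x \<in> carrier X" for c x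
  proof -
    have "T (\<pi> (c \<odot> x)) = c \<odot> T (\<pi> x)"
      using lin x quot_map_closed by (simp add: quot_map_smult linear_op_def)
    then show ?thesis
      using x T_closed quot_map_closed
      by (simp add: p_def a_minus_def smult_simps smult_r_minus)
  qed
  ultimately have "linear_selection X J p"
    using p_best metric_projection_iff by (auto simp: linear_selection_def linear_op_def)
  then show ?thesis by blast
qed

lemma QLP_if_linear_selection:
  assumes "linear_selection X J p"
  shows "QLP TYPE('y) X J"
  unfolding QLP_def
proof (intro allI impI)
  fix Y :: "('k, 'y) normed_space" and S
  assume "banach_space Y \<and> bounded_linear_op Y Q S"
  then have bounded: "bounded_linear_op Y Q S"
    and lin: "linear_op Y Q S" by (auto simp: bounded_linear_op_def)
  have p_in: "p x \<in> J" and p_nrm: "nrm X (x \<ominus> p x) = nrm Q (\<pi> x)" if "x \<in> carrier X" for x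
    using assms that metric_projection_iff by (auto simp: linear_selection_def)
  have p_add: "p (x \<oplus> y) = p x \<oplus> p y" if "x \<in> carrier X" "y \<in> carrier X" for x y
    using assms that by (simp add: linear_selection_def linear_op_def)
  have p_smult: "p (c \<odot> x) = c \<odot> p x" if "x \<in> carrier X" for c x
    using assms that by (simp add: linear_selection_def linear_op_def)
  have p_closed: "p x \<in> carrier X" if "x \<in> carrier X" for x
    using p_in J_carrier that by blast
  \<comment> \<open>The distance from \<open>j\<close> to \<open>J\<close> is \<open>0\<close>, so \<open>j\<close> is its only best approximation.\<close>
  have p_J: "p j = j" if j: "j \<in> J" for j
  proof -
    have jX: "j \<in> carrier X" using j by (rule J_carrier)
    have "\<pi> j = \<pi> \<zero>"
      using j quot_map_eq_zero by simp
    then have "nrm X (j \<ominus> p j) = 0"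
      using p_nrm[OF jX] quot_nrm_le[of \<zero>] quot_nrm_nonneg[OF quot_map_closed, of \<zero>]
        nrm_zero by simp
    then show ?thesis
      using jX p_closed by (simp add: nrm_eq_zero_iff diff_eq_zero_iff)
  qed
  define q where "q x = x \<ominus> p x" for x
  have q_closed: "q x \<in> carrier X" if "x \<in> carrier X" for x
    using that p_closed by (simp add: q_def)
  have q_add: "q (x \<oplus> y) = q x \<oplus> q y" if "x \<in> carrier X" "y \<in> carrier X" for x y
    using that p_closed by (simp add: q_def p_add a_minus_def M.minus_add M.a_ac)
  have q_smult: "q (c \<odot> x) = c \<odot> q x" if "x \<in> carrier X" for c x
    using that p_closed by (simp add: q_def p_smult a_minus_def smult_simps smult_r_minus)
  have q_cong: "q x = q y" if xy: "x \<in> carrier X" "y \<in> carrier X" "\<pi> x = \<pi> y" for x y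
  proof -
    have j: "x \<ominus> y \<in> J" using xy quot_map_eq_iff by blast
    have "x = (x \<ominus> y) \<oplus> y" using xy by (simp add: a_minus_def M.a_assoc M.l_neg)
    then have "q x = q (x \<ominus> y) \<oplus> q y" using q_add[of "x \<ominus> y" y] xy by simp
    also have "q (x \<ominus> y) = \<zero>"
      using j p_J xy by (simp add: q_def diff_eq_zero_iff)
    finally show ?thesis using q_closed xy by simp
  qed
  have \<pi>_q: "\<pi> (q x) = \<pi> x" if x: "x \<in> carrier X" for x
  proof -
    have "q x \<ominus> x = \<ominus> p x"
      using x p_closed by (simp add: q_def diff_diff_cancel)
    then show ?thesis
      using x q_closed p_in by (simp add: quot_map_eq_iff)
  qed
  \<comment> \<open>By \<open>q_cong\<close> the value does not depend on the chosen representative of \<open>S y\<close>, which is what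
      makes \<open>T\<close> linear.\<close>
  define T where "T y = q (SOME x. x \<in> carrier X \<and> \<pi> x = S y)" for y
  have T_eq: "T y = q x" if "x \<in> carrier X" "\<pi> x = S y" for x y
  proof -
    have "\<exists>x. x \<in> carrier X \<and> \<pi> x = S y" using that by blast
    from someI_ex[OF this] show ?thesis
      unfolding T_def by (intro q_cong) (use that in auto)
  qed
  have rep: "\<exists>x. x \<in> carrier X \<and> \<pi> x = S y" if "y \<in> carrier Y" for y
    using lin that quot_carrierE[of "S y"] by (metis linear_op_def funcset_mem)
  have T_S: "\<pi> (T y) = S y" "nrm X (T y) = nrm Q (S y)" "T y \<in> carrier X"
    if y: "y \<in> carrier Y" for y
  proof -
    obtain x where x: "x \<in> carrier X" "\<pi> x = S y" using rep[OF y] by blast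
    show "\<pi> (T y) = S y" "nrm X (T y) = nrm Q (S y)" "T y \<in> carrier X"
      using T_eq[OF x] x \<pi>_q q_closed p_nrm by (simp_all add: q_def)
  qed
  have "linear_op Y X T"
    unfolding linear_op_def
  proof (intro conjI ballI allI)
    show "T \<in> carrier Y \<rightarrow> carrier X" using T_S by blast
    fix y assume y: "y \<in> carrier Y"
    obtain x where x: "x \<in> carrier X" "\<pi> x = S y" using rep[OF y] by blast
    show "T (c \<odot>\<^bsub>Y\<^esub> y) = c \<odot> T y" for c
    proof -
      have "\<pi> (c \<odot> x) = S (c \<odot>\<^bsub>Y\<^esub> y)"
        using lin x y by (simp add: quot_map_smult linear_op_def)
      then show ?thesis
        using T_eq[of "c \<odot> x"] T_eq[OF x] x by (simp add: smult_simps q_smult)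
    qed
    fix y' assume y': "y' \<in> carrier Y"
    obtain x' where x': "x' \<in> carrier X" "\<pi> x' = S y'" using rep[OF y'] by blast
    have "\<pi> (x \<oplus> x') = S (y \<oplus>\<^bsub>Y\<^esub> y')"
      using lin x y x' y' by (simp add: quot_map_add linear_op_def)
    then show "T (y \<oplus>\<^bsub>Y\<^esub> y') = T y \<oplus> T y'"
      using T_eq[of "x \<oplus> x'"] T_eq[OF x] T_eq[OF x'] x x' by (simp add: q_add)
  qed
  then have "bounded_linear_op Y X T"
    using bounded T_S by (simp add: bounded_linear_op_def)
  moreover have "op_norm Y X T = op_norm Y Q S"
    unfolding op_norm_def by (rule SUP_cong) (simp_all add: T_S)
  ultimately show "\<exists>T. bounded_linear_op Y X T \<and> (\<forall>y\<in>carrier Y. \<pi> (T y) = S y) \<and>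
      op_norm Y X T = op_norm Y Q S"
    using T_S(1) by blast
qed

end

theorem mainTheorem9:
  fixes X :: "('k::{real_normed_field, banach}, 'v) normed_space" and J :: "'v set"
  assumes "banach_space X" and "closed_subspace X J" and "proximinal X J"
  shows "(QLP TYPE('v set) X J \<longleftrightarrow> (\<exists>p. linear_selection X J p)) \<and>
         ((\<exists>p. linear_selection X J p) \<longrightarrow> QLP TYPE('y) X J)"
proof -
  interpret banach_subspace X J
    using assms(1,2) by (intro banach_subspace.intro banach_subspace_axioms.intro)
  show ?thesis
    by (intro conjI iffI impI; (erule linear_selection_if_QLP | (erule exE, erule QLP_if_linear_selection)))
qed

end
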